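(* Let $\ell\ge 1$ be an integer and let $p_\ell=1\,2\cdots(\ell+1)$ be the increasing permutation of length $\ell+1$. For each integer $k\ge \ell+1$ there exists a positive integer $n_0=n_0(k,p_\ell)$ such that for all $n\ge n_0$, $$\mathrm{op}_{n,k+1}(p_\ell)>\mathrm{op}_{n,k}(p_\ell)>\cdots>\mathrm{op}_{n,\ell+1}(p_\ell),$$ that is, $\mathrm{op}_{n,j+1}(p_\ell)>\mathrm{op}_{n,j}(p_\ell)$ for every $j$ with $\ell+1\le j\le k$.
   Context: $[n]=\{1,\dots,n\}$. An ordered partition of $[n]$ into $k$ blocks is a sequence $\pi=B_1/B_2/\cdots/B_k$ of nonempty pairwise disjoint subsets with union $[n]$. For a permutation $p=p_1\cdots p_m$ of $[m]$, such $\pi$ contains $p$ if there exist integers $1\le i_1<\cdots<i_m\le k$ and elements $b_j\in B_{i_j}$ ($1\le j\le m$) such that $b_1\cdots b_m$ is order isomorphic to $p$ (i.e. $b_s<b_t\iff p_s<p_t$); otherwise $\pi$ avoids $p$. $\mathrm{op}_{n,k}(p)$ is the number of ordered partitions of $[n]$ into $k$ blocks that avoid $p$. *)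

theory Defs
  imports Main "HOL-Library.Disjoint_Sets"
begin

text \<open>
  A permutation \<open>p\<^sub>1 \<dots> p\<^sub>m\<close> is the list of its values (with values
  in \<open>{1..m}\<close>), and a sequence of blocks is a list of sets; list positions count from 0.
\<close>

text \<open>
  \<^const>\<open>partition_on\<close> only sees the set of blocks, so \<^const>\<open>distinct\<close> is what makes
  blocks at different positions disjoint.
\<close>

definition ordered_partitions :: "nat \<Rightarrow> nat \<Rightarrow> nat set list set" where
  "ordered_partitions n k =
     {\<pi>. length \<pi> = k \<and> distinct \<pi> \<and> partition_on {1..n} (set \<pi>)}"

definition order_isomorphic :: "nat list \<Rightarrow> nat list \<Rightarrow> bool" where
  "order_isomorphic b p \<longleftrightarrow> length b = length p \<and>
     (\<forall>s<length p. \<forall>t<length p. b ! s < b ! t \<longleftrightarrow> p ! s < p ! t)"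

definition op_contains :: "nat set list \<Rightarrow> nat list \<Rightarrow> bool" where
  "op_contains \<pi> p \<longleftrightarrow>
     (\<exists>i b. strict_mono_on {..<length p} i \<and>
            (\<forall>j<length p. i j < length \<pi> \<and> b ! j \<in> \<pi> ! i j) \<and>
            order_isomorphic b p)"

definition op_avoiders :: "nat \<Rightarrow> nat \<Rightarrow> nat list \<Rightarrow> nat set list set" where
  "op_avoiders n k p = {\<pi> \<in> ordered_partitions n k. \<not> op_contains \<pi> p}"

definition op_count :: "nat \<Rightarrow> nat \<Rightarrow> nat list \<Rightarrow> nat" where
  "op_count n k p = card (op_avoiders n k p)"

definition increasing_perm :: "nat \<Rightarrow> nat list" where
  "increasing_perm l = [1..<l + 2]"

lemma length_increasing_perm: "length (increasing_perm l) = l + 1"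
  by (simp add: increasing_perm_def)

lemma nth_increasing_perm: "s \<le> l \<Longrightarrow> increasing_perm l ! s = s + 1"
  unfolding increasing_perm_def by (subst nth_upt) auto

lemma ordered_partitions_iff:
  "\<pi> \<in> ordered_partitions n k \<longleftrightarrow>
     length \<pi> = k \<and> (\<forall>i<k. \<pi> ! i \<noteq> {}) \<and>
     (\<forall>i<k. \<forall>j<k. i \<noteq> j \<longrightarrow> \<pi> ! i \<inter> \<pi> ! j = {}) \<and> (\<Union>i<k. \<pi> ! i) = {1..n}"
  (is "?L \<longleftrightarrow> ?R")
proof
  assume ?L
  then have l: "length \<pi> = k" and d: "distinct \<pi>" and u: "\<Union> (set \<pi>) = {1..n}"
    and dis: "disjoint (set \<pi>)" and ne: "{} \<notin> set \<pi>"
    by (simp_all add: ordered_partitions_def partition_on_def)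
  have "\<pi> ! i \<noteq> {}" if "i < k" for i
    using that l ne by (metis nth_mem)
  moreover have "\<pi> ! i \<inter> \<pi> ! j = {}" if "i < k" "j < k" "i \<noteq> j" for i j
    using that l d dis by (metis disjointD nth_mem nth_eq_iff_index_eq)
  moreover have "(\<Union>i<k. \<pi> ! i) = {1..n}"
    unfolding u[symmetric] l[symmetric] by (auto simp: set_conv_nth)
  ultimately show ?R using l by blast
next
  assume R: ?R
  then have "distinct \<pi>"
    unfolding distinct_conv_nth by (metis Int_absorb)
  moreover have "disjoint (set \<pi>)"
    using R unfolding disjoint_def by (metis in_set_conv_nth)
  moreover have "{} \<notin> set \<pi>" using R by (metis in_set_conv_nth)
  moreover have "\<Union> (set \<pi>) = {1..n}"
  proof -
    have "set \<pi> = (!) \<pi> ` {..<k}" using R by (auto simp: set_conv_nth)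
    then show ?thesis using R by simp
  qed
  ultimately show ?L using R by (simp add: ordered_partitions_def partition_on_def)
qed

lemma finite_op_avoiders: "finite (op_avoiders n k p)"
proof (rule finite_subset)
  show "op_avoiders n k p \<subseteq> {\<pi>. set \<pi> \<subseteq> Pow {1..n} \<and> length \<pi> = k}"
    by (auto simp: op_avoiders_def ordered_partitions_def partition_on_def)
  show "finite {\<pi>. set \<pi> \<subseteq> Pow {1..n} \<and> length \<pi> = k}"
    by (rule finite_lists_length_eq) simp
qed

end

theory Submission
  imports Defs
begin

text \<open>
  Splitting one block into two consecutive ones, the larger elements in front of the smaller
  ones, creates no new increasing pattern: an increasing pattern can never use both halves, so
  merging the halves again turns it into an increasing pattern of the original partition.

  An ordered partition of \<open>{1..n}\<close> into \<open>k\<close> blocks can be split in this way in \<open>n - k\<close> ways, one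
  for each element \<open>t\<close> that is not the maximum of its block (the elements up to \<open>t\<close> form the second
  half).  Conversely, the result together with the index \<open>c < k\<close> of the split block determines
  the original partition and \<open>t\<close>.  Double counting gives, writing \<open>a k\<close> for the number of avoiders
  with \<open>k\<close> blocks, the inequality \<open>a k * (n - k) \<le> a (k + 1) * k\<close>
  (lemma \<open>op_count_split_le\<close>).  The one-block partition avoids every pattern of length at least
  two, so the inequality yields \<open>a k > 0\<close> for \<open>1 \<le> k \<le> n\<close>, and then \<open>a k < a (k + 1)\<close> as soon as
  \<open>n > 2 * k\<close>.
\<close>

lemma op_contains_increasing_iff:
  "op_contains \<pi> (increasing_perm l) \<longleftrightarrow>
     (\<exists>i b. strict_mono_on {..l} i \<and> strict_mono_on {..l} b \<and>
            (\<forall>s\<le>l. i s < length \<pi> \<and> b s \<in> \<pi> ! i s))"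
  (is "?L \<longleftrightarrow> ?R")
proof
  assume ?L
  then obtain i b where i: "strict_mono_on {..<l + 1} i"
    and m: "\<forall>j<l + 1. i j < length \<pi> \<and> b ! j \<in> \<pi> ! i j"
    and o: "order_isomorphic b (increasing_perm l)"
    unfolding op_contains_def length_increasing_perm by blast
  have "strict_mono_on {..l} ((!) b)"
    using o unfolding order_isomorphic_def length_increasing_perm
    by (auto simp: strict_mono_on_def nth_increasing_perm)
  moreover have "strict_mono_on {..l} i"
    using i by (simp add: lessThan_Suc_atMost)
  moreover have "\<forall>s\<le>l. i s < length \<pi> \<and> b ! s \<in> \<pi> ! i s"
    using m by simp
  ultimately show ?R by blast
next
  assume ?R
  then obtain i b where i: "strict_mono_on {..l} i" and b: "strict_mono_on {..l} b"
    and m: "\<forall>s\<le>l. i s < length \<pi> \<and> b s \<in> \<pi> ! i s" by blast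
  have nth: "map b [0..<l + 1] ! s = b s" if "s \<le> l" for s
    using that by (subst nth_map) (auto simp del: upt_Suc)
  have "b s < b t \<longleftrightarrow> s < t" if "s \<le> l" "t \<le> l" for s t
    using strict_mono_on_less[OF b, of s t] that by simp
  then have "order_isomorphic (map b [0..<l + 1]) (increasing_perm l)"
    unfolding order_isomorphic_def length_increasing_perm
    by (simp add: nth nth_increasing_perm less_Suc_eq_le Suc_le_eq del: upt_Suc)
  moreover have "strict_mono_on {..<l + 1} i"
    using i by (simp add: lessThan_Suc_atMost)
  moreover have "\<forall>j<l + 1. i j < length \<pi> \<and> map b [0..<l + 1] ! j \<in> \<pi> ! i j"
    using m nth by (simp add: less_Suc_eq_le del: upt_Suc)
  ultimately show ?L
    unfolding op_contains_def length_increasing_perm by blast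
qed

text \<open>
  When block \<open>c\<close> has been replaced by its two halves, at positions \<open>c\<close> and \<open>Suc c\<close>, this is the
  position that a block had before, with both halves sent back to \<open>c\<close>.
\<close>

definition merge_index :: "nat \<Rightarrow> nat \<Rightarrow> nat" where
  "merge_index c i = (if i \<le> c then i else i - 1)"

definition split_block :: "nat set list \<Rightarrow> nat \<Rightarrow> nat \<Rightarrow> nat set list" where
  "split_block \<pi> c t =
     map (\<lambda>i. \<pi> ! merge_index c i \<inter>
              (if i = c then {t<..} else if i = Suc c then {..t} else UNIV))
         [0..<Suc (length \<pi>)]"

lemma length_split_block [simp]: "length (split_block \<pi> c t) = Suc (length \<pi>)"
  by (simp add: split_block_def)

lemma nth_split_block:
  assumes "i \<le> length \<pi>"
  shows "split_block \<pi> c t ! i = \<pi> ! merge_index c i \<inter>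
           (if i = c then {t<..} else if i = Suc c then {..t} else UNIV)"
  using assms unfolding split_block_def by (subst nth_map) (auto simp del: upt_Suc)

lemma nth_split_block_cases:
  assumes "c < length \<pi>"
  shows "i < c \<Longrightarrow> split_block \<pi> c t ! i = \<pi> ! i"
    and "split_block \<pi> c t ! c = \<pi> ! c \<inter> {t<..}"
    and "split_block \<pi> c t ! Suc c = \<pi> ! c \<inter> {..t}"
    and "c < i \<Longrightarrow> i < length \<pi> \<Longrightarrow> split_block \<pi> c t ! Suc i = \<pi> ! i"
  using assms by (simp_all add: nth_split_block merge_index_def)

lemma merge_index_eq_iff:
  assumes "i < i'"
  shows "merge_index c i = merge_index c i' \<longleftrightarrow> i = c \<and> i' = Suc c"
  using assms by (auto simp: merge_index_def)

lemma finite_ordered_partition_block: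
  assumes "\<pi> \<in> ordered_partitions n k" "c < k"
  shows "finite (\<pi> ! c)"
proof (rule finite_subset)
  show "\<pi> ! c \<subseteq> {1..n}" using assms unfolding ordered_partitions_iff by blast
qed simp

lemma split_block_in_ordered_partitions:
  assumes \<pi>: "\<pi> \<in> ordered_partitions n k" and c: "c < k"
    and t: "t \<in> \<pi> ! c" "t \<noteq> Max (\<pi> ! c)"
  shows "split_block \<pi> c t \<in> ordered_partitions n (Suc k)"
proof -
  have len: "length \<pi> = k" and ne: "\<And>i. i < k \<Longrightarrow> \<pi> ! i \<noteq> {}"
    and dis: "\<And>i j. i < k \<Longrightarrow> j < k \<Longrightarrow> i \<noteq> j \<Longrightarrow> \<pi> ! i \<inter> \<pi> ! j = {}"
    and un: "(\<Union>i<k. \<pi> ! i) = {1..n}"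
    using \<pi> unfolding ordered_partitions_iff by auto
  let ?\<sigma> = "split_block \<pi> c t"
  have mi: "merge_index c i < k" if "i < Suc k" for i
    using that c by (auto simp: merge_index_def)
  have sub: "?\<sigma> ! i \<subseteq> \<pi> ! merge_index c i" if "i < Suc k" for i
    using that len by (auto simp: nth_split_block)
  have fin: "finite (\<pi> ! c)" using \<pi> c by (rule finite_ordered_partition_block)
  have "Max (\<pi> ! c) \<in> \<pi> ! c" using Max_in[OF fin] t(1) by blast
  moreover have "t < Max (\<pi> ! c)" using Max_ge[OF fin t(1)] t(2) by linarith
  ultimately
  have halves: "\<pi> ! c \<inter> {t<..} \<noteq> {}" "\<pi> ! c \<inter> {..t} \<noteq> {}"
    using t(1) by auto
  have "?\<sigma> ! i \<noteq> {}" if "i < Suc k" for i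
    using that c halves ne[OF mi[OF that]]
    by (auto simp: nth_split_block merge_index_def len split: if_splits)
  moreover have less: "?\<sigma> ! i \<inter> ?\<sigma> ! j = {}" if "i < j" "j < Suc k" for i j
  proof (cases "merge_index c i = merge_index c j")
    case True
    then have "i = c" "j = Suc c" using merge_index_eq_iff[OF that(1)] by auto
    then show ?thesis using c len by (auto simp: nth_split_block_cases)
  next
    case False
    then have "\<pi> ! merge_index c i \<inter> \<pi> ! merge_index c j = {}"
      using dis mi that by simp
    then show ?thesis using sub[of i] sub[of j] that by auto
  qed
  then have "?\<sigma> ! i \<inter> ?\<sigma> ! j = {}" if "i < Suc k" "j < Suc k" "i \<noteq> j" for i j
    using that by (metis Int_commute linorder_neqE_nat)
  moreover have "(\<Union>i<Suc k. ?\<sigma> ! i) = {1..n}"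
  proof
    show "(\<Union>i<Suc k. ?\<sigma> ! i) \<subseteq> {1..n}"
      using sub mi unfolding un[symmetric] by blast
    show "{1..n} \<subseteq> (\<Union>i<Suc k. ?\<sigma> ! i)"
    proof
      fix x assume "x \<in> {1..n}"
      then obtain i where i: "i < k" "x \<in> \<pi> ! i" unfolding un[symmetric] by blast
      then have "x \<in> ?\<sigma> ! i \<or> x \<in> ?\<sigma> ! Suc i"
        using c len nth_split_block_cases[where \<pi> = \<pi> and c = c and t = t]
        by (cases i c rule: linorder_cases) auto
      then show "x \<in> (\<Union>i<Suc k. ?\<sigma> ! i)"
        using i(1) by (meson UN_I Suc_less_eq lessThan_iff less_SucI)
    qed
  qed
  ultimately show ?thesis
    unfolding ordered_partitions_iff by (simp add: len)
qed

text \<open>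
  Merging the two halves keeps the block indices of an increasing pattern strictly increasing,
  because two entries in different halves would be decreasing.
\<close>

lemma op_contains_increasing_split_blockD:
  assumes c: "c < length \<pi>"
    and cont: "op_contains (split_block \<pi> c t) (increasing_perm l)"
  shows "op_contains \<pi> (increasing_perm l)"
proof -
  obtain i b where i: "strict_mono_on {..l} i" and b: "strict_mono_on {..l} b"
    and m: "\<And>s. s \<le> l \<Longrightarrow> i s < Suc (length \<pi>) \<and> b s \<in> split_block \<pi> c t ! i s"
    using cont unfolding op_contains_increasing_iff by auto
  have "strict_mono_on {..l} (\<lambda>s. merge_index c (i s))"
  proof (rule strict_mono_onI)
    fix s s' assume s: "s \<in> {..l}" "s' \<in> {..l}" "s < s'"
    have lt: "i s < i s'" "b s < b s'"
      using i b s by (auto simp: strict_mono_on_def)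
    have "merge_index c (i s) \<noteq> merge_index c (i s')"
    proof
      assume "merge_index c (i s) = merge_index c (i s')"
      then have "i s = c" "i s' = Suc c" using merge_index_eq_iff[OF lt(1)] by auto
      then have "b s > t" "b s' \<le> t"
        using m[of s] m[of s'] s c by (auto simp: nth_split_block_cases)
      then show False using lt(2) by simp
    qed
    moreover have "merge_index c (i s) \<le> merge_index c (i s')"
      using lt(1) by (auto simp: merge_index_def)
    ultimately show "merge_index c (i s) < merge_index c (i s')" by simp
  qed
  moreover have "merge_index c (i s) < length \<pi> \<and> b s \<in> \<pi> ! merge_index c (i s)"
    if "s \<le> l" for s
    using m[OF that] c by (auto simp: nth_split_block merge_index_def split: if_splits)
  ultimately show ?thesis
    unfolding op_contains_increasing_iff using b by blast
qed

lemma split_block_eqD: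
  assumes len: "c < length \<pi>" "length \<pi>' = length \<pi>"
    and t: "t \<in> \<pi> ! c" "t' \<in> \<pi>' ! c"
    and eq: "split_block \<pi> c t = split_block \<pi>' c t'"
  shows "\<pi> = \<pi>' \<and> t = t'"
proof
  have c': "c < length \<pi>'" using len by simp
  note nth = nth_split_block_cases[OF len(1), where t = t]
    nth_split_block_cases[OF c', where t = t']
  have hi: "\<pi> ! c \<inter> {t<..} = \<pi>' ! c \<inter> {t'<..}" and lo: "\<pi> ! c \<inter> {..t} = \<pi>' ! c \<inter> {..t'}"
    using arg_cong[OF eq, of "\<lambda>\<sigma>. \<sigma> ! c"] arg_cong[OF eq, of "\<lambda>\<sigma>. \<sigma> ! Suc c"]
    unfolding nth(2,3,6,7) by simp_all
  show "\<pi> = \<pi>'"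
  proof (rule nth_equalityI)
    fix i assume i: "i < length \<pi>"
    show "\<pi> ! i = \<pi>' ! i"
    proof (cases i c rule: linorder_cases)
      case less
      then show ?thesis using arg_cong[OF eq, of "\<lambda>\<sigma>. \<sigma> ! i"] by (simp add: nth(1,5))
    next
      case equal
      have "\<pi> ! c = (\<pi> ! c \<inter> {t<..}) \<union> (\<pi> ! c \<inter> {..t})" by auto
      also have "\<dots> = \<pi>' ! c" unfolding hi lo by auto
      finally show ?thesis using equal by simp
    next
      case greater
      then show ?thesis using arg_cong[OF eq, of "\<lambda>\<sigma>. \<sigma> ! Suc i"] i len(2)
        by (simp add: nth(4,8))
    qed
  qed (use len in simp)
  have "t \<in> \<pi>' ! c \<inter> {..t'}" "t' \<in> \<pi> ! c \<inter> {..t}"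
    using lo t by blast+
  then show "t = t'" by auto
qed

text \<open>
  Splitting at the maximum of a block would leave the front half empty; every other element of
  \<open>{1..n}\<close> gives a split.
\<close>

lemma card_split_points_ge:
  assumes "\<pi> \<in> ordered_partitions n k"
  shows "n - k \<le> card (SIGMA c:{..<k}. \<pi> ! c - {Max (\<pi> ! c)})" (is "_ \<le> card ?T")
proof -
  have len: "length \<pi> = k" and un: "(\<Union>i<k. \<pi> ! i) = {1..n}"
    using assms unfolding ordered_partitions_iff by auto
  have fin: "finite ?T"
    using finite_ordered_partition_block[OF assms] by (intro finite_SigmaI finite_Diff) auto
  have "n - k \<le> card {1..n} - card (Max ` set \<pi>)"
    using card_image_le[of "set \<pi>" Max] card_length[of \<pi>] len by simp
  also have "\<dots> \<le> card ({1..n} - Max ` set \<pi>)"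
    by (rule diff_card_le_card_Diff) simp
  also have "\<dots> \<le> card (snd ` ?T)"
  proof (rule card_mono)
    show "finite (snd ` ?T)" using fin by simp
    show "{1..n} - Max ` set \<pi> \<subseteq> snd ` ?T"
    proof
      fix t assume t: "t \<in> {1..n} - Max ` set \<pi>"
      then obtain c where c: "c < k" "t \<in> \<pi> ! c" unfolding un[symmetric] by blast
      then have "\<pi> ! c \<in> set \<pi>" using len by simp
      then have "(c, t) \<in> ?T" using c t by blast
      then show "t \<in> snd ` ?T" by (metis image_eqI snd_conv)
    qed
  qed
  also have "\<dots> \<le> card ?T" by (rule card_image_le[OF fin])
  finally show ?thesis .
qed

text \<open>
  The triples of an avoider, a block index and a splitting point in that block are counted in two
  ways.  Each avoider has at least \<open>n - k\<close> splitting points, so the left side is a lower bound for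
  their number; a triple is recovered from the split partition, which again avoids the pattern,
  and the block index, so the right side is an upper bound.
\<close>

lemma op_count_split_le:
  "op_count n k (increasing_perm l) * (n - k) \<le> op_count n (Suc k) (increasing_perm l) * k"
proof -
  let ?p = "increasing_perm l"
  let ?A = "op_avoiders n k ?p" and ?A' = "op_avoiders n (Suc k) ?p"
  define T where "T \<pi> = (SIGMA c:{..<k}. \<pi> ! c - {Max (\<pi> ! c)})" for \<pi> :: "nat set list"
  define F where "F = (\<lambda>(\<pi>, c, t :: nat). (split_block \<pi> c t, c))"
  have A: "\<pi> \<in> ordered_partitions n k" "\<not> op_contains \<pi> ?p" "length \<pi> = k"
    if "\<pi> \<in> ?A" for \<pi>
    using that unfolding op_avoiders_def ordered_partitions_def by auto
  have finT: "finite (T \<pi>)" if "\<pi> \<in> ?A" for \<pi>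
    unfolding T_def using finite_ordered_partition_block[OF A(1)[OF that]]
    by (intro finite_SigmaI finite_Diff) auto
  have "op_count n k ?p * (n - k) = (\<Sum>\<pi>\<in>?A. n - k)"
    by (simp add: op_count_def)
  also have "\<dots> \<le> (\<Sum>\<pi>\<in>?A. card (T \<pi>))"
    unfolding T_def by (intro sum_mono card_split_points_ge A(1))
  also have "\<dots> = card (Sigma ?A T)"
    using finT by (simp add: finite_op_avoiders)
  also have "\<dots> \<le> card (?A' \<times> {..<k})"
  proof (rule card_inj_on_le)
    show "inj_on F (Sigma ?A T)"
    proof (rule inj_onI)
      fix x x' assume x: "x \<in> Sigma ?A T" "x' \<in> Sigma ?A T" and eq: "F x = F x'"
      obtain \<pi> c t \<pi>' c' t' where xx: "x = (\<pi>, c, t)" "x' = (\<pi>', c', t')"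
        by (metis prod_cases3)
      have h: "\<pi> \<in> ?A" "\<pi>' \<in> ?A" "(c, t) \<in> T \<pi>" "(c', t') \<in> T \<pi>'"
        using x xx by auto
      have c: "c' = c" and split: "split_block \<pi> c t = split_block \<pi>' c t'"
        using eq xx by (auto simp: F_def)
      have "\<pi> = \<pi>' \<and> t = t'"
        using h(3,4) A(3)[OF h(1)] A(3)[OF h(2)] c
        by (intro split_block_eqD[OF _ _ _ _ split]) (auto simp: T_def)
      then show "x = x'" using xx c by simp
    qed
    show "F ` Sigma ?A T \<subseteq> ?A' \<times> {..<k}"
    proof (rule image_subsetI; clarify)
      fix \<pi> c t assume h: "\<pi> \<in> ?A" "(c, t) \<in> T \<pi>"
      then have ct: "c < k" "t \<in> \<pi> ! c" "t \<noteq> Max (\<pi> ! c)" by (auto simp: T_def)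
      have "split_block \<pi> c t \<in> ?A'"
        using split_block_in_ordered_partitions[OF A(1)[OF h(1)] ct]
          op_contains_increasing_split_blockD[of c \<pi> t l] A(2,3)[OF h(1)] ct(1)
        by (auto simp: op_avoiders_def)
      then show "F (\<pi>, c, t) \<in> ?A' \<times> {..<k}" using ct(1) by (simp add: F_def)
    qed
    show "finite (?A' \<times> {..<k})" by (simp add: finite_op_avoiders)
  qed
  also have "\<dots> = op_count n (Suc k) ?p * k"
    by (simp add: op_count_def card_cartesian_product)
  finally show ?thesis .
qed

lemma op_count_one_pos:
  assumes "l \<ge> 1" "n \<ge> 1"
  shows "op_count n 1 (increasing_perm l) > 0"
proof -
  have "[{1..n}] \<in> ordered_partitions n 1"
    using assms(2) by (simp add: ordered_partitions_def partition_on_def)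
  moreover have "\<not> op_contains [{1..n}] (increasing_perm l)"
  proof
    assume "op_contains [{1..n}] (increasing_perm l)"
    then obtain i :: "nat \<Rightarrow> nat" where i: "strict_mono_on {..l} i" "\<forall>s\<le>l. i s < 1"
      unfolding op_contains_increasing_iff by auto
    have "i 0 < i 1" using i(1) assms(1) by (auto simp: strict_mono_on_def)
    then show False using i(2) assms(1) by auto
  qed
  ultimately have "op_avoiders n 1 (increasing_perm l) \<noteq> {}"
    unfolding op_avoiders_def by blast
  then show ?thesis
    unfolding op_count_def by (simp add: card_gt_0_iff finite_op_avoiders)
qed

lemma op_count_increasing_pos:
  assumes "l \<ge> 1" "1 \<le> k" "k \<le> n"
  shows "op_count n k (increasing_perm l) > 0"
  using assms(2,3)
proof (induction k rule: dec_induct)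
  case base
  then show ?case using op_count_one_pos assms(1) by simp
next
  case (step k)
  then have "0 < op_count n k (increasing_perm l) * (n - k)" by simp
  also note op_count_split_le
  finally show ?case by simp
qed

theorem theorem2p7:
  fixes l k :: nat
  assumes "l \<ge> 1" and "k \<ge> l + 1"
  shows "\<exists>n\<^sub>0>0. \<forall>n\<ge>n\<^sub>0. \<forall>j. l + 1 \<le> j \<and> j \<le> k \<longrightarrow>
           op_count n (j + 1) (increasing_perm l) > op_count n j (increasing_perm l)"
proof (intro exI[of _ "2 * k + 1"] conjI allI impI)
  show "0 < 2 * k + 1" by simp
  fix n j assume n: "2 * k + 1 \<le> n" and j: "l + 1 \<le> j \<and> j \<le> k"
  let ?a = "\<lambda>j. op_count n j (increasing_perm l)"
  have "?a j > 0" using op_count_increasing_pos assms(1) n j by simp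
  moreover have "j < n - j" using n j by linarith
  ultimately have "?a j * j < ?a j * (n - j)" by simp
  also have "\<dots> \<le> ?a (j + 1) * j" using op_count_split_le by simp
  finally show "?a j < ?a (j + 1)" by simp
qed

end
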